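(* For all nonnegative integers $r_1,r_2$ and every positive integer $n\ge r_1+r_2+2$, \begin{align*} &\frac{1}{r_1!\,r_2!}\sum_{\substack{i+j+k=2n\\ i,j,k\ge1}}\frac{B_iB_jB_k}{i!\,j!\,k!}\prod_{a=1}^{r_1}(i-a)\prod_{b=1}^{r_2}(j-b)\\ &=\mathop{\mathrm{Cyc}}_{r_1,r_2}\left(\frac{(-1)^{r_1+r_2}B_{r_1+1}B_{2n-r_1-1}}{(r_1+1)!\,(2n-r_1-1)!}+\frac{\delta_{r_1,0}}{2}\binom{2n-3}{r_2}\frac{B_{2n-2}}{(2n-2)!}\right)\\ &\quad+\left(\binom{2n}{r_1+r_2+2}+\mathop{\mathrm{Cyc}}_{r_1,r_2}(-1)^{r_2}\binom{2n}{r_1+1}+(-1)^{r_1+r_2}\right)\frac{B_{2n}}{(2n)!}\\ &\quad+\mathop{\mathrm{Cyc}}_{r_1,r_2}(-1)^{r_1}\sum_{k=r_1+1}^{r_1+r_2+1}\binom{k-1}{r_1}\binom{2n-k-1}{r_2+r_1+1-k}\frac{B_k}{k!}\frac{B_{2n-k}}{(2n-k)!}\\ &\quad+\mathop{\mathrm{Cyc}}_{r_1,r_2}(-1)^{r_2}\sum_{k=1}^{r_1+1}\binom{2n-1-k}{r_1+1-k}\frac{B_k}{k!}\frac{B_{2n-k}}{(2n-k)!}\\ &\quad+\sum_{k=1}^{r_2}(-1)^k\binom{2n-1-k}{r_1+r_2+2-k}\frac{B_k}{k!}\frac{B_{2n-k}}{(2n-k)!}\\ &\quad-\sum_{k=0}^{r_2}\sum_{j=r_2+2}^{r_1+r_2+1}(-1)^{r_2}\binom{j-1-k}{r_2+1-k}\binom{2n-1-j}{r_1+r_2+2-j}\frac{B_kB_{j-k}B_{2n-j}}{k!\,(j-k)!\,(2n-j)!}\\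 &\quad+\sum_{k=0}^{r_2}\sum_{j=r_1+1+k}^{r_1+r_2+1}(-1)^{r_1+k}\binom{j-1-k}{r_1}\binom{2n-1-j}{r_1+r_2+2-j}\frac{B_kB_{j-k}B_{2n-j}}{k!\,(j-k)!\,(2n-j)!}. \end{align*}
   Context: The Bernoulli numbers $B_j$ are defined by $\frac{t}{e^t-1}=\sum_{j\ge0}B_j\frac{t^j}{j!}$ (so $B_0=1$, $B_1=-1/2$). $\delta$ is the Kronecker delta. For any expression $f(r_1,r_2)$, $\mathop{\mathrm{Cyc}}_{r_1,r_2} f(r_1,r_2)=f(r_1,r_2)+f(r_2,r_1)$ (roles of $r_1,r_2$ interchanged everywhere, including in $\delta_{r_1,0}$, signs and summation limits). Binomial coefficients $\binom{a}{b}$ vanish for $b<0$ or $b>a$; empty sums are $0$ and empty products are $1$. *)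

theory Defs
  imports Complex_Main "HOL-Computational_Algebra.Formal_Power_Series"
begin

definition bernoulli :: "nat \<Rightarrow> real" where
  "bernoulli j = fact j * fps_nth (fps_X / (fps_exp 1 - 1)) j"

text \<open>
  The series \<open>fps_exp 1 - 1\<close> has zero constant term, so it is not a unit. The division of
  formal power series is nevertheless exact here, as the following lemma confirms.
\<close>

lemma bernoulli_generating_function:
  "Abs_fps (\<lambda>j. bernoulli j / fact j) * (fps_exp 1 - 1) = fps_X"
proof -
  let ?E = "fps_exp 1 - 1 :: real fps"
  have nz: "fps_nth ?E 1 \<noteq> 0" by simp
  have "subdegree ?E = 1" by (rule subdegreeI) auto
  moreover have "?E \<noteq> 0" using nz by (metis fps_zero_nth)
  ultimately have "?E dvd fps_X"
    by (subst fps_dvd_iff) auto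
  moreover have "Abs_fps (\<lambda>j. bernoulli j / fact j) = fps_X / ?E"
    by (simp add: fps_eq_iff bernoulli_def)
  ultimately show ?thesis by simp
qed

definition Cyc :: "(nat \<Rightarrow> nat \<Rightarrow> real) \<Rightarrow> nat \<Rightarrow> nat \<Rightarrow> real" where
  "Cyc f r\<^sub>1 r\<^sub>2 = f r\<^sub>1 r\<^sub>2 + f r\<^sub>2 r\<^sub>1"

definition kronecker_delta :: "nat \<Rightarrow> nat \<Rightarrow> real" where
  "kronecker_delta a b = (if a = b then 1 else 0)"

end

theory Submission
  imports Defs
begin

text \<open>
  Put \<open>H(t) = 1 / (e\<^sup>t - 1)\<close> and \<open>b\<^sub>k = B\<^sub>k / k!\<close>. The sum is the coefficient of \<open>t\<^sup>2\<^sup>n\<close> in the product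
  of the series \<open>t\<^bsup>r+1\<^esup> H\<^bsup>(r)\<^esup> / r!\<close> for \<open>r = r\<^sub>1, r\<^sub>2, 0\<close>, each with its constant term removed.
  The addition formula \<open>H(x) H(y) = H(x + y) (1 + H(x) + H(y))\<close>, expanded in \<open>y\<close>, writes
  \<open>H H\<^bsup>(s)\<^esup>\<close> as a linear combination of derivatives of \<open>H\<close>; differentiating, the same holds for
  \<open>H\<^bsup>(r)\<^esup> H\<^bsup>(s)\<^esup>\<close>, the coefficients being the Bernoulli numbers in the polar part of the product.
  Applying this twice linearises the triple product, and the vanishing of \<open>B\<^sub>k\<close> for odd \<open>k \<ge> 3\<close>
  brings the resulting coefficient into the stated form.
\<close>

section \<open>Bernoulli coefficients and their parity\<close>

definition bern_coeff :: "nat \<Rightarrow> real" where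
  "bern_coeff k = bernoulli k / fact k"

text \<open>
  \<open>bern_deriv r\<close> is \<open>t\<^bsup>r+1\<^esup> H\<^bsup>(r)\<^esup>(t) / r!\<close>; the factor \<open>t\<^bsup>r+1\<^esup>\<close> clears the pole.
\<close>

definition bern_deriv :: "nat \<Rightarrow> real fps" where
  "bern_deriv r = Abs_fps (\<lambda>k. ((real k - 1) gchoose r) * bern_coeff k)"

lemma bern_deriv_0: "bern_deriv 0 = Abs_fps bern_coeff"
  by (simp add: bern_deriv_def)

lemma bern_deriv_0_mult_exp: "bern_deriv 0 * fps_exp 1 = bern_deriv 0 + fps_X"
proof -
  have "bern_deriv 0 * (fps_exp 1 - 1) = fps_X"
    using bernoulli_generating_function by (simp add: bern_deriv_0 bern_coeff_def[abs_def])
  then show ?thesis by (simp add: algebra_simps)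
qed

text \<open>Compares the coefficients of \<open>t^(m+1)\<close> in
  \<open>bern_deriv 0 * (fps_exp 1 - 1) = fps_X\<close>; the summand \<open>k = m + 1\<close> is
  zero because \<open>e^t - 1\<close> has no constant term.\<close>

lemma bern_coeff_recurrence:
  "(\<Sum>k\<le>m. bern_coeff k / fact (m + 1 - k)) = (if m = 0 then 1 else 0)"
proof -
  have "fps_nth (bern_deriv 0 * (fps_exp 1 - 1)) (m + 1) = fps_nth fps_X (m + 1)"
    using bern_deriv_0_mult_exp by (simp add: algebra_simps)
  moreover have "fps_nth (bern_deriv 0 * (fps_exp 1 - 1)) (m + 1)
      = (\<Sum>k = 0..m + 1. bern_coeff k * (if k = m + 1 then 0 else 1 / fact (m + 1 - k)))"
    unfolding fps_mult_nth by (intro sum.cong) (auto simp: bern_deriv_0)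
  moreover have "\<dots> = (\<Sum>k\<le>m. bern_coeff k / fact (m + 1 - k))"
    by (simp add: atMost_atLeast0)
  ultimately show ?thesis by (simp split: if_splits)
qed

lemma bern_coeff_0 [simp]: "bern_coeff 0 = 1"
  using bern_coeff_recurrence[of 0] by simp

lemma bern_coeff_1: "bern_coeff (Suc 0) = - 1 / 2"
  using bern_coeff_recurrence[of 1] by simp

text \<open>Replacing \<open>t\<close> by \<open>-t\<close> in \<open>B(t) = t / (e^t - 1)\<close>
  gives \<open>B(-t) = B(t) + t\<close>; the claim is the coefficient of \<open>t^k\<close>. All
  parity arguments below rest on it.\<close>

lemma minus_one_power_mult_bern_coeff:
  "(-1) ^ k * bern_coeff k = bern_coeff k + (if k = 1 then 1 else 0)"
proof -
  let ?B = "bern_deriv 0" and ?E = "fps_exp 1 :: real fps" and ?M = "fps_const (-1) * fps_X :: real fps"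
  let ?B' = "fps_compose ?B ?M"
  have B: "?B * (?E - 1) = fps_X" using bern_deriv_0_mult_exp by (simp add: algebra_simps)
  have E': "fps_compose ?E ?M = fps_exp (-1)"
    using fps_exp_compose_linear[of 1 "-1 :: real"] by simp
  have "fps_compose (?B * (?E - 1)) ?M = fps_compose fps_X ?M"
    by (simp only: B)
  then have B': "?B' * (fps_exp (-1) - 1) = - fps_X"
    by (simp add: fps_compose_mult_distrib fps_compose_sub_distrib E' flip: fps_const_neg)
  have EE: "fps_exp (-1) * ?E = 1"
    using fps_exp_add_mult[of "-1::real" 1] by simp
  \<comment> \<open>Multiplication by \<open>e^t\<close> turns \<open>e^(-t) - 1\<close> into
    \<open>1 - e^t\<close>, so that \<open>?B'\<close> and \<open>?B + fps_X\<close> can be compared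
    through the common factor \<open>?E - 1\<close>.\<close>
  have "- fps_X * ?E = ?B' * (fps_exp (-1) * ?E - ?E)"
    unfolding B'[symmetric] by (simp only: algebra_simps mult_1_left)
  then have "?B' * (?E - 1) = fps_X * ?E" unfolding EE by (simp add: algebra_simps)
  also have "\<dots> = (?B + fps_X) * (?E - 1)" using B by (simp add: algebra_simps)
  finally have "?B' = ?B + fps_X"
    using B by (metis fps_X_neq_zero mult_cancel_right mult_zero_right)
  then have "fps_nth ?B' k = fps_nth (?B + fps_X) k" by simp
  then show ?thesis unfolding fps_nth_compose_linear by (simp add: bern_deriv_0)
qed

lemma bern_coeff_odd: "odd k \<Longrightarrow> k \<noteq> 1 \<Longrightarrow> bern_coeff k = 0"
  using minus_one_power_mult_bern_coeff[of k] by simp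

section \<open>Derivatives of \<open>H\<close> under the Euler operator
  \<open>t d/dt\<close>\<close>

lemma fps_X_mult_deriv_nth: "fps_nth (fps_X * fps_deriv f) k = of_nat k * fps_nth f k"
  by (cases k) auto

lemma Suc_times_gbinomial_Suc:
  fixes a :: "'a :: field_char_0"
  shows "of_nat (k + 1) * (a gchoose (k + 1)) = (a - of_nat k) * (a gchoose k)"
  using gbinomial_mult_1[of a k] by (simp add: algebra_simps)

text \<open>The product rule for \<open>t d/dt\<close> on \<open>t^(r+1) H^(r) / r!\<close>: the
  power reproduces the series \<open>r + 1\<close> times, and \<open>H^(r)\<close> passes to the
  next order. On coefficients this is the absorption identity for binomials.\<close>

lemma bern_deriv_Suc:
  "fps_X * fps_deriv (bern_deriv r) = of_nat (r + 1) * (bern_deriv r + bern_deriv (r + 1))"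
proof (rule fps_ext)
  fix k
  have "real k * ((real k - 1) gchoose r)
      = real (r + 1) * (((real k - 1) gchoose r) + ((real k - 1) gchoose (r + 1)))"
    using Suc_times_gbinomial_Suc[of r "real k - 1"] by (simp add: algebra_simps)
  then show "fps_nth (fps_X * fps_deriv (bern_deriv r)) k
      = fps_nth (of_nat (r + 1) * (bern_deriv r + bern_deriv (r + 1))) k"
    unfolding fps_X_mult_deriv_nth fps_mult_of_nat_nth
    by (simp add: bern_deriv_def flip: mult.assoc distrib_right)
qed

section \<open>The addition formula\<close>

text \<open>The coefficient of \<open>y^k\<close> in \<open>e^(ty)\<close>; scaling \<open>y\<close>
  by \<open>t\<close> matches the powers of \<open>t\<close> that clear the poles.\<close>

definition exp_term :: "nat \<Rightarrow> real fps" where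
  "exp_term k = fps_const (1 / fact k) * fps_X ^ k"

lemma fps_X_mult_exp_term: "fps_X * exp_term k = of_nat (k + 1) * exp_term (k + 1)"
proof -
  have "fps_const (1 / fact k) = of_nat (k + 1) * fps_const (1 / fact (k + 1) :: real)"
    by (simp flip: fps_of_nat)
  then show ?thesis by (simp add: exp_term_def mult_ac)
qed

lemma fps_X_mult_deriv_exp_term: "fps_X * fps_deriv (exp_term k) = of_nat k * exp_term k"
  by (rule fps_ext) (simp only: fps_X_mult_deriv_nth fps_mult_of_nat_nth, simp add: exp_term_def)

text \<open>
  The lemma \<open>exp_mult_bern_shift\<close> below is the coefficient of \<open>y\<^sup>m\<close> in \<open>H(x + y) (e\<^bsup>x+y\<^esup> - 1) = 1\<close>.
\<close>

definition bern_shift :: "nat \<Rightarrow> real fps" where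
  "bern_shift m = (\<Sum>a\<le>m. exp_term (m - a) * bern_deriv a)"

text \<open>By the Leibniz rule \<open>e^t * bern_shift m\<close> is
  \<open>t^(m+1) (e^t H)^(m) / m!\<close>. This is therefore the rule \<open>bern_deriv_Suc\<close>
  for \<open>e^t H\<close> in place of \<open>H\<close>, divided by \<open>e^t\<close>.\<close>

lemma bern_shift_Suc:
  "fps_X * fps_deriv (bern_shift m) + fps_X * bern_shift m
     = of_nat (m + 1) * (bern_shift m + bern_shift (m + 1))"
proof -
  let ?T = exp_term and ?h = bern_deriv
  have "fps_X * fps_deriv (bern_shift m)
      = (\<Sum>a\<le>m. (fps_X * fps_deriv (?T (m - a))) * ?h a + ?T (m - a) * (fps_X * fps_deriv (?h a)))"
    by (simp add: bern_shift_def fps_deriv_sum sum_distrib_left algebra_simps)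
  \<comment> \<open>The weights \<open>m - a\<close> and \<open>a + 1\<close> of the two factors add
    up to \<open>m + 1\<close> for every \<open>a\<close>; the other sum raises the order of the
    derivative.\<close>
  also have "\<dots> = (\<Sum>a\<le>m. of_nat (m + 1) * (?T (m - a) * ?h a)
                       + of_nat (a + 1) * ?T (m + 1 - (a + 1)) * ?h (a + 1))"
    unfolding fps_X_mult_deriv_exp_term bern_deriv_Suc
    by (intro sum.cong) (auto simp: algebra_simps of_nat_diff)
  also have "\<dots> = of_nat (m + 1) * bern_shift m
                  + (\<Sum>a\<le>m. of_nat (a + 1) * ?T (m + 1 - (a + 1)) * ?h (a + 1))"
    by (simp add: sum.distrib bern_shift_def sum_distrib_left)
  also have "(\<Sum>a\<le>m. of_nat (a + 1) * ?T (m + 1 - (a + 1)) * ?h (a + 1))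
      = (\<Sum>a\<le>m + 1. of_nat a * ?T (m + 1 - a) * ?h a)"
    by (simp add: sum.atMost_Suc_shift del: sum.atMost_Suc)
  finally have 1: "fps_X * fps_deriv (bern_shift m) = of_nat (m + 1) * bern_shift m
      + (\<Sum>a\<le>m + 1. of_nat a * ?T (m + 1 - a) * ?h a)" .
  have "fps_X * bern_shift m = (\<Sum>a\<le>m. (fps_X * ?T (m - a)) * ?h a)"
    by (simp add: bern_shift_def sum_distrib_left mult_ac)
  also have "\<dots> = (\<Sum>a\<le>m. of_nat (m + 1 - a) * ?T (m + 1 - a) * ?h a)"
    unfolding fps_X_mult_exp_term by (intro sum.cong) (auto simp: Suc_diff_le)
  also have "\<dots> = (\<Sum>a\<le>m + 1. of_nat (m + 1 - a) * ?T (m + 1 - a) * ?h a)" by simp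
  finally have 2: "fps_X * bern_shift m = (\<Sum>a\<le>m + 1. of_nat (m + 1 - a) * ?T (m + 1 - a) * ?h a)" .
  \<comment> \<open>The remaining weights \<open>a\<close> and \<open>m + 1 - a\<close> are
    complementary, so the two sums together form a multiple of
    \<open>bern_shift (m + 1)\<close>.\<close>
  have "(\<Sum>a\<le>m + 1. of_nat a * ?T (m + 1 - a) * ?h a)
        + (\<Sum>a\<le>m + 1. of_nat (m + 1 - a) * ?T (m + 1 - a) * ?h a) = of_nat (m + 1) * bern_shift (m + 1)"
    unfolding bern_shift_def sum_distrib_left sum.distrib[symmetric]
    by (intro sum.cong refl) (simp add: of_nat_diff algebra_simps)
  then show ?thesis unfolding 1 2 by (simp add: distrib_left add.assoc)
qed

lemma exp_mult_bern_shift: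
  "fps_exp 1 * bern_shift m = bern_deriv m + (if m = 0 then fps_X else 0)"
proof (induction m)
  case 0
  then show ?case using bern_deriv_0_mult_exp by (simp add: bern_shift_def exp_term_def mult.commute)
next
  case (Suc m)
  let ?c = "of_nat (m + 1) :: real fps" and ?\<epsilon> = "if m = 0 then fps_X else 0 :: real fps"
  \<comment> \<open>The Euler operator applied to the identity for \<open>m\<close> yields
    \<open>?c\<close> times the sum of the identities for \<open>m\<close> and
    \<open>m + 1\<close>.\<close>
  have "?c * (fps_exp 1 * bern_shift m + fps_exp 1 * bern_shift (m + 1))
      = fps_exp 1 * (fps_X * fps_deriv (bern_shift m) + fps_X * bern_shift m)"
    unfolding bern_shift_Suc by (simp add: algebra_simps)
  also have "\<dots> = fps_X * fps_deriv (fps_exp 1 * bern_shift m)"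
    by (simp add: algebra_simps)
  \<comment> \<open>\<open>?\<epsilon>\<close> is nonzero only for \<open>m = 0\<close>; there
    \<open>?c = 1\<close>, and the Euler operator fixes \<open>fps_X\<close>.\<close>
  also have "\<dots> = fps_X * fps_deriv (bern_deriv m) + ?c * ?\<epsilon>"
    by (simp add: Suc.IH algebra_simps)
  also have "\<dots> = ?c * (bern_deriv m + bern_deriv (m + 1) + ?\<epsilon>)"
    unfolding bern_deriv_Suc by (simp add: algebra_simps)
  finally have "fps_exp 1 * bern_shift m + fps_exp 1 * bern_shift (m + 1)
      = bern_deriv m + bern_deriv (m + 1) + ?\<epsilon>"
    by (simp del: of_nat_Suc of_nat_add)
  then show ?case unfolding Suc.IH by simp
qed

lemma fps_const_sum: "fps_const (sum f A) = (\<Sum>x\<in>A. fps_const (f x))"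
  by (rule fps_ext) (simp add: fps_sum_nth)

text \<open>The coefficient of \<open>y^s\<close> in
  \<open>H(x) H(x+y) = - H(x+y) - H(y) (H(x+y) - H(x))\<close>, a rearrangement of the addition
  formula. The sum stops at \<open>s\<close> because \<open>H(x) H(y)\<close> cancels the term
  \<open>k = s + 1\<close>.\<close>

lemma bern_deriv_0_mult:
  "bern_deriv 0 * bern_deriv s
     = - fps_X * bern_deriv s - (\<Sum>k\<le>s. fps_const (bern_coeff k) * fps_X ^ k * bern_deriv (s + 1 - k))"
proof -
  let ?B = "bern_deriv 0" and ?h = bern_deriv and ?b = "\<lambda>k. fps_const (bern_coeff k)"
  \<comment> \<open>Multiplying \<open>exp_mult_bern_shift\<close> by \<open>?B\<close> eliminates
    the exponential, since \<open>?B * fps_exp 1 = ?B + fps_X\<close>.\<close>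
  have shift: "fps_X * ?h m = - (?B + fps_X) * (\<Sum>a<m. exp_term (m - a) * ?h a)" if "m > 0" for m
  proof -
    have "bern_shift m = (\<Sum>a<m. exp_term (m - a) * ?h a) + ?h m"
      unfolding bern_shift_def by (simp add: exp_term_def flip: lessThan_Suc_atMost)
    then have "(?B + fps_X) * (\<Sum>a<m. exp_term (m - a) * ?h a)
        = ?B * (fps_exp 1 * bern_shift m) - ?B * fps_exp 1 * ?h m"
      unfolding bern_deriv_0_mult_exp[symmetric] by (simp add: algebra_simps)
    also have "\<dots> = - fps_X * ?h m"
      unfolding bern_deriv_0_mult_exp exp_mult_bern_shift using that by (simp add: algebra_simps)
    finally show ?thesis by (simp only: mult_minus_left minus_minus)
  qed
  \<comment> \<open>The power of \<open>fps_X\<close> does not depend on \<open>k\<close>, so the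
    inner sum over \<open>k\<close> becomes a sum of numbers.\<close>
  have coeff: "?b k * fps_X ^ k * exp_term (s + 1 - k - a)
      = fps_const (bern_coeff k / fact (s - a + 1 - k)) * fps_X ^ (s + 1 - a)"
    if "a + k \<le> s" for a k
  proof -
    have "k + (s + 1 - k - a) = s + 1 - a" "s + 1 - k - a = s - a + 1 - k" using that by auto
    then have "fps_X ^ (s + 1 - a) = fps_X ^ k * (fps_X :: real fps) ^ (s - a + 1 - k)"
      by (metis power_add)
    moreover have "fps_const (bern_coeff k / fact (s - a + 1 - k))
        = ?b k * fps_const (1 / fact (s - a + 1 - k))" by simp
    ultimately show ?thesis using \<open>s + 1 - k - a = s - a + 1 - k\<close>
      by (simp only: exp_term_def mult_ac)
  qed
  \<comment> \<open>Convolving \<open>shift\<close> with the coefficients of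
    \<open>y / (e^y - 1)\<close> undoes the factor \<open>e^y - 1\<close>: once the sums are
    exchanged, \<open>bern_coeff_recurrence\<close> leaves only \<open>a = s\<close>.\<close>
  have "fps_X * (\<Sum>k\<le>s. ?b k * fps_X ^ k * ?h (s + 1 - k))
      = (\<Sum>k\<le>s. ?b k * fps_X ^ k * (fps_X * ?h (s + 1 - k)))"
    by (simp add: sum_distrib_left mult_ac)
  also have "\<dots> = (\<Sum>k\<le>s. ?b k * fps_X ^ k * (- (?B + fps_X) * (\<Sum>a\<le>s - k. exp_term (s + 1 - k - a) * ?h a)))"
    by (intro sum.cong refl) (subst shift, simp, simp add: Suc_diff_le lessThan_Suc_atMost)
  also have "\<dots> = - (?B + fps_X) * (\<Sum>k\<le>s. \<Sum>a\<le>s - k. ?b k * fps_X ^ k * exp_term (s + 1 - k - a) * ?h a)"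
    by (simp add: sum_distrib_left mult_ac)
  also have "(\<Sum>k\<le>s. \<Sum>a\<le>s - k. ?b k * fps_X ^ k * exp_term (s + 1 - k - a) * ?h a)
      = (\<Sum>a\<le>s. \<Sum>k\<le>s - a. ?b k * fps_X ^ k * exp_term (s + 1 - k - a) * ?h a)"
    unfolding sum.Sigma[OF finite_atMost ballI[OF finite_atMost]]
    by (rule sum.reindex_bij_witness[of _ "\<lambda>(a, k). (k, a)" "\<lambda>(a, k). (k, a)"]) auto
  also have "\<dots> = (\<Sum>a\<le>s. fps_const (\<Sum>k\<le>s - a. bern_coeff k / fact (s - a + 1 - k)) * fps_X ^ (s + 1 - a) * ?h a)"
    unfolding fps_const_sum sum_distrib_right by (intro sum.cong refl) (subst coeff, auto)
  also have "\<dots> = (\<Sum>a\<le>s. if a = s then fps_X * ?h s else 0)"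
    unfolding bern_coeff_recurrence by (intro sum.cong) auto
  also have "\<dots> = fps_X * ?h s" by simp
  finally have "fps_X * (\<Sum>k\<le>s. ?b k * fps_X ^ k * ?h (s + 1 - k)) = fps_X * (- (?B + fps_X) * ?h s)"
    by (simp add: algebra_simps)
  then have "(\<Sum>k\<le>s. ?b k * fps_X ^ k * ?h (s + 1 - k)) = - (?B + fps_X) * ?h s"
    by (simp only: mult_cancel_left) simp
  then show ?thesis by (simp add: algebra_simps)
qed

section \<open>Linearising a product of two derivatives\<close>

text \<open>These values are forced by the polar part of \<open>H^(r) H^(s) / (r! s!)\<close>. For
  \<open>k = 0\<close> the two leading poles meet; for \<open>k \<ge> 1\<close> the pole of one
  factor meets the regular part of the other.\<close>

definition prod_coeff :: "nat \<Rightarrow> nat \<Rightarrow> nat \<Rightarrow> real" where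
  "prod_coeff r s k = (if k = 0 then - 1 else
     - ((-1) ^ k * ((-1) ^ s * real ((k - 1) choose s) + (-1) ^ r * real ((k - 1) choose r)) * bern_coeff k))"

text \<open>Identifies the coefficients in \<open>bern_deriv_0_mult\<close>: the rule for
  \<open>(-1) ^ k * bern_coeff k\<close> removes the signs, produces the term \<open>- fps_X\<close>
  at \<open>k = 1\<close>, and otherwise cancels the entry \<open>k = s + 1\<close>.\<close>

lemma prod_coeff_0_left:
  assumes "k \<le> s + 1"
  shows "prod_coeff 0 s k = - (if k \<le> s then bern_coeff k else 0) - (if k = 1 then 1 else 0)"
proof (cases "k = s + 1")
  case True
  then have "prod_coeff 0 s k = bern_coeff k - (-1) ^ k * bern_coeff k"
    by (simp add: prod_coeff_def algebra_simps flip: power_add)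
  then show ?thesis using True minus_one_power_mult_bern_coeff[of k] by auto
next
  case False
  then have "k \<le> s" using assms by simp
  then have "prod_coeff 0 s k = - ((-1) ^ k * bern_coeff k)"
    by (auto simp: prod_coeff_def binomial_eq_0)
  then show ?thesis
    using \<open>k \<le> s\<close> by (simp add: minus_one_power_mult_bern_coeff)
qed

text \<open>The recursion that the Euler operator imposes on the expansion of
  \<open>bern_deriv r * bern_deriv s\<close>; it reduces to absorption, once for \<open>s\<close>
  and once for \<open>r\<close>.\<close>

lemma prod_coeff_Suc_left:
  "real (r + 1) * prod_coeff (r + 1) s k
     = (real (r + s + 2) - real k) * prod_coeff r s k - real (s + 1) * prod_coeff r (s + 1) k"
proof (cases k)
  case 0
  then show ?thesis by (simp add: prod_coeff_def)
next
  case (Suc l)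
  let ?C = "\<lambda>s. real (l choose s)"
  have C: "real (s + 1) * ?C (s + 1) = (real l - real s) * ?C s" for s
    using Suc_times_gbinomial_Suc[of s "real l"] by (simp add: binomial_gbinomial)
  define u v where "u = ((-1) ^ s :: real)" and "v = ((-1) ^ r :: real)"
  have "real (r + 1) * (u * ?C s - v * ?C (r + 1))
      = (real (r + s + 1) - real l) * (u * ?C s + v * ?C r) - real (s + 1) * (- u * ?C (s + 1) + v * ?C r)"
    using arg_cong[OF C[of s], of "(*) u"] arg_cong[OF C[of r], of "(*) v"]
    by (simp add: algebra_simps)
  from arg_cong[OF this, of "(*) (- ((-1) ^ k * bern_coeff k))"] show ?thesis using Suc
    by (simp add: prod_coeff_def u_def[symmetric] v_def[symmetric] algebra_simps)
qed

lemma fps_X_mult_deriv_X_power: "fps_X * fps_deriv (fps_X ^ k) = of_nat k * (fps_X ^ k :: 'a :: comm_ring_1 fps)"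
  by (rule fps_ext) (simp only: fps_X_mult_deriv_nth fps_mult_of_nat_nth, simp)

text \<open>Induction on \<open>r\<close>. The Euler operator turns the product for
  \<open>(r, s)\<close> into those for \<open>(r + 1, s)\<close> and \<open>(r, s + 1)\<close>; the
  latter is known by induction, which is why \<open>s\<close> is arbitrary.\<close>

lemma bern_deriv_mult:
  "bern_deriv r * bern_deriv s
     = (\<Sum>k\<le>r + s + 1. fps_const (prod_coeff r s k) * fps_X ^ k * bern_deriv (r + s + 1 - k))"
proof (induction r arbitrary: s)
  case 0
  have "(\<Sum>k\<le>s + 1. fps_const (prod_coeff 0 s k) * fps_X ^ k * bern_deriv (s + 1 - k))
      = (\<Sum>k\<le>s + 1. - (if k = 1 then fps_X * bern_deriv s else 0)
           - (if k \<le> s then fps_const (bern_coeff k) * fps_X ^ k * bern_deriv (s + 1 - k) else 0))"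
    by (intro sum.cong) (auto simp: prod_coeff_0_left Suc_le_eq algebra_simps simp flip: fps_const_add fps_const_sub fps_const_neg)
  also have "\<dots> = - fps_X * bern_deriv s
      - (\<Sum>k\<le>s. fps_const (bern_coeff k) * fps_X ^ k * bern_deriv (s + 1 - k))"
    unfolding sum_subtractf sum_negf by simp
  finally show ?case by (simp add: bern_deriv_0_mult)
next
  case (Suc r)
  let ?h = bern_deriv and ?a = "\<lambda>r s k. fps_const (prod_coeff r s k)"
  let ?N = "r + s + 2"
  \<comment> \<open>The power contributes the weight \<open>k\<close> and the derivative
    \<open>?N - k\<close>, so every term is reproduced \<open>?N\<close> times; these multiples
    cancel against the product rule below.\<close>
  have term_deriv: "fps_X * fps_deriv (?a r s k * fps_X ^ k * ?h (r + s + 1 - k))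
      = of_nat ?N * (?a r s k * fps_X ^ k * ?h (r + s + 1 - k))
        + fps_const (real ?N - real k) * ?a r s k * fps_X ^ k * ?h (?N - k)" if "k \<le> r + s + 1" for k
  proof -
    have N: "r + s + 1 - k + 1 = ?N - k" using that by auto
    have "fps_X * fps_deriv (?a r s k * fps_X ^ k * ?h (r + s + 1 - k))
       = ?a r s k * ((fps_X * fps_deriv (fps_X ^ k)) * ?h (r + s + 1 - k)
            + fps_X ^ k * (fps_X * fps_deriv (?h (r + s + 1 - k))))"
      by (simp add: algebra_simps del: fps_deriv_power)
    also have "\<dots> = ?a r s k * (of_nat (k + (?N - k)) * fps_X ^ k * ?h (r + s + 1 - k)
            + of_nat (?N - k) * fps_X ^ k * ?h (?N - k))"
      unfolding fps_X_mult_deriv_X_power bern_deriv_Suc N by (simp only: of_nat_add algebra_simps)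
    also have "k + (?N - k) = ?N" using that by simp
    also have "(of_nat (?N - k) :: real fps) = fps_const (real ?N - real k)"
      using that by (simp add: of_nat_diff flip: fps_of_nat)
    finally show ?thesis by (simp only: algebra_simps)
  qed
  have "fps_X * fps_deriv (?h r * ?h s)
      = (\<Sum>k\<le>r + s + 1. fps_X * fps_deriv (?a r s k * fps_X ^ k * ?h (r + s + 1 - k)))"
    unfolding Suc.IH by (simp only: fps_deriv_sum sum_distrib_left)
  also have "\<dots> = (\<Sum>k\<le>r + s + 1. of_nat ?N * (?a r s k * fps_X ^ k * ?h (r + s + 1 - k))
        + fps_const (real ?N - real k) * ?a r s k * fps_X ^ k * ?h (?N - k))"
    by (intro sum.cong refl term_deriv) simp
  also have "\<dots> = of_nat ?N * (?h r * ?h s)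
      + (\<Sum>k\<le>r + s + 1. fps_const (real ?N - real k) * ?a r s k * fps_X ^ k * ?h (?N - k))"
    unfolding Suc.IH by (simp only: sum.distrib sum_distrib_left)
  \<comment> \<open>The added summand \<open>k = ?N\<close> has the factor
    \<open>real ?N - real k = 0\<close>.\<close>
  also have "(\<Sum>k\<le>r + s + 1. fps_const (real ?N - real k) * ?a r s k * fps_X ^ k * ?h (?N - k))
      = (\<Sum>k\<le>?N. fps_const (real ?N - real k) * ?a r s k * fps_X ^ k * ?h (?N - k))"
    by simp
  finally have D: "fps_X * fps_deriv (?h r * ?h s) = of_nat ?N * (?h r * ?h s)
      + (\<Sum>k\<le>?N. fps_const (real ?N - real k) * ?a r s k * fps_X ^ k * ?h (?N - k))" .
  have "fps_X * fps_deriv (?h r * ?h s)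
      = (fps_X * fps_deriv (?h r)) * ?h s + ?h r * (fps_X * fps_deriv (?h s))"
    by (simp add: algebra_simps)
  also have "\<dots> = of_nat ?N * (?h r * ?h s)
      + of_nat (r + 1) * (?h (r + 1) * ?h s) + of_nat (s + 1) * (?h r * ?h (s + 1))"
    unfolding bern_deriv_Suc by (simp add: algebra_simps)
  finally have "of_nat (r + 1) * (?h (r + 1) * ?h s)
      = (\<Sum>k\<le>?N. fps_const (real ?N - real k) * ?a r s k * fps_X ^ k * ?h (?N - k))
        - of_nat (s + 1) * (?h r * ?h (s + 1))"
    unfolding D by (simp add: algebra_simps)
  also have "of_nat (s + 1) * (?h r * ?h (s + 1))
      = (\<Sum>k\<le>?N. fps_const (real (s + 1)) * ?a r (s + 1) k * fps_X ^ k * ?h (?N - k))"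
    unfolding Suc.IH fps_of_nat by (simp add: sum_distrib_left mult.assoc del: sum.atMost_Suc of_nat_Suc of_nat_add)
  also have "(\<Sum>k\<le>?N. fps_const (real ?N - real k) * ?a r s k * fps_X ^ k * ?h (?N - k)) - \<dots>
      = (\<Sum>k\<le>?N. fps_const (real (r + 1) * prod_coeff (r + 1) s k) * fps_X ^ k * ?h (?N - k))"
    unfolding sum_subtractf[symmetric] prod_coeff_Suc_left
    by (intro sum.cong refl) (simp only: fps_const_mult left_diff_distrib[symmetric] fps_const_sub)
  also have "\<dots> = of_nat (r + 1) * (\<Sum>k\<le>?N. ?a (r + 1) s k * fps_X ^ k * ?h (?N - k))"
    unfolding sum_distrib_left fps_of_nat[symmetric] fps_const_mult[symmetric] by (simp only: mult.assoc)
  finally have "?h (r + 1) * ?h s = (\<Sum>k\<le>?N. ?a (r + 1) s k * fps_X ^ k * ?h (?N - k))"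
    by (simp only: mult_cancel_left of_nat_eq_0_iff) simp
  then show ?case by simp
qed

section \<open>Coefficients of products of two derivatives\<close>

text \<open>For odd \<open>k\<close> the index \<open>m - k\<close> is odd and, being at least 2,
  differs from 1; hence both sides vanish.\<close>

lemma bern_coeff_diff_parity:
  assumes "even m" "k + 2 \<le> m"
  shows "(-1) ^ k * bern_coeff (m - k) = bern_coeff (m - k)"
  using assms bern_coeff_odd[of "m - k"] by (cases "even k") auto

lemma bern_deriv_nth:
  "fps_nth (bern_deriv l) k = (if k = 0 then (-1) ^ l else real ((k - 1) choose l) * bern_coeff k)"
proof (cases k)
  case 0
  have "((-1 :: real) gchoose l) = (-1) ^ l"
    using gbinomial_minus[of "1 :: real" l] binomial_gbinomial[of l l, where ?'a = real] by simp
  then show ?thesis using 0 by (simp add: bern_deriv_def)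
next
  case (Suc j)
  then show ?thesis by (simp add: bern_deriv_def binomial_gbinomial)
qed

lemma X_power_mult_bern_deriv_nth:
  assumes "k < m"
  shows "fps_nth (fps_X ^ k * bern_deriv l) m = real ((m - k - 1) choose l) * bern_coeff (m - k)"
  using assms by (simp add: fps_X_power_mult_nth bern_deriv_nth)

text \<open>Reads \<open>bern_deriv_mult\<close> coefficientwise. The bound on \<open>m\<close>
  keeps every \<open>m - (i + k)\<close> at least 2, so parity trades the sign
  \<open>(-1) ^ k\<close> of \<open>prod_coeff\<close> for \<open>(-1) ^ i\<close>.\<close>

lemma bern_deriv_mult_nth:
  assumes "even m" "i + r + s + 3 \<le> m"
  shows "fps_nth (fps_X ^ i * (bern_deriv r * bern_deriv s)) m
     = - real ((m - i - 1) choose (r + s + 1)) * bern_coeff (m - i)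
       - (-1) ^ i * (\<Sum>k = 1..r + s + 1.
           ((-1) ^ s * real ((k - 1) choose s) + (-1) ^ r * real ((k - 1) choose r))
           * real ((m - (i + k) - 1) choose (r + s + 1 - k)) * bern_coeff k * bern_coeff (m - (i + k)))"
proof -
  let ?C = "\<lambda>k. (-1) ^ s * real ((k - 1) choose s) + (-1) ^ r * real ((k - 1) choose r)"
  let ?D = "\<lambda>k. real ((m - (i + k) - 1) choose (r + s + 1 - k))"
  have sgn: "(-1) ^ k * bern_coeff (m - (i + k)) = (-1) ^ i * bern_coeff (m - (i + k))"
    if "k \<le> r + s + 1" for k
  proof -
    have "(-1) ^ i * ((-1) ^ (i + k) * bern_coeff (m - (i + k))) = (-1) ^ i * bern_coeff (m - (i + k))"
      using assms that by (subst bern_coeff_diff_parity) auto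
    then show ?thesis by (simp add: power_add flip: mult.assoc)
  qed
  have "fps_X ^ i * (bern_deriv r * bern_deriv s)
      = (\<Sum>k\<le>r + s + 1. fps_const (prod_coeff r s k) * (fps_X ^ (i + k) * bern_deriv (r + s + 1 - k)))"
    unfolding bern_deriv_mult sum_distrib_left by (intro sum.cong) (auto simp: power_add mult_ac)
  then have "fps_nth (fps_X ^ i * (bern_deriv r * bern_deriv s)) m
      = (\<Sum>k\<le>r + s + 1. prod_coeff r s k * (?D k * bern_coeff (m - (i + k))))"
    using assms by (simp only: fps_sum_nth fps_mult_left_const_nth)
      (intro sum.cong refl, subst X_power_mult_bern_deriv_nth, auto)
  also have "{..r + s + 1} = insert 0 {1..r + s + 1}" by auto
  also have "(\<Sum>k \<in> insert 0 {1..r + s + 1}. prod_coeff r s k * (?D k * bern_coeff (m - (i + k))))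
      = - (?D 0 * bern_coeff (m - i)) + (\<Sum>k = 1..r + s + 1. prod_coeff r s k * (?D k * bern_coeff (m - (i + k))))"
    by (subst sum.insert) (auto simp: prod_coeff_def)
  also have "(\<Sum>k = 1..r + s + 1. prod_coeff r s k * (?D k * bern_coeff (m - (i + k))))
      = (\<Sum>k = 1..r + s + 1. - ((-1) ^ i) * (?C k * ?D k * bern_coeff k * bern_coeff (m - (i + k))))"
  proof (intro sum.cong refl)
    fix k assume k: "k \<in> {1..r + s + 1}"
    have "prod_coeff r s k * (?D k * bern_coeff (m - (i + k)))
        = - (?C k * ?D k * bern_coeff k) * ((-1) ^ k * bern_coeff (m - (i + k)))"
      using k by (simp add: prod_coeff_def)
    then show "prod_coeff r s k * (?D k * bern_coeff (m - (i + k)))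
        = - ((-1) ^ i) * (?C k * ?D k * bern_coeff k * bern_coeff (m - (i + k)))"
      using k by (subst (asm) sgn) auto
  qed
  finally show ?thesis by (simp only: sum_distrib_left[symmetric]) simp
qed

lemma bern_deriv_0_mult_nth:
  assumes "even m" "s + 4 \<le> m"
  shows "fps_nth (bern_deriv 0 * bern_deriv s) m
     = - (\<Sum>k\<le>s. real ((m - k - 1) choose (s + 1 - k)) * bern_coeff k * bern_coeff (m - k))"
proof -
  have "bern_coeff (m - 1) = 0" using assms by (intro bern_coeff_odd) auto
  then have "fps_nth (fps_X * bern_deriv s) m = 0"
    using X_power_mult_bern_deriv_nth[of 1 m s] assms by simp
  moreover have "fps_nth (\<Sum>k\<le>s. fps_const (bern_coeff k) * fps_X ^ k * bern_deriv (s + 1 - k)) m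
      = (\<Sum>k\<le>s. real ((m - k - 1) choose (s + 1 - k)) * bern_coeff k * bern_coeff (m - k))"
    unfolding fps_sum_nth mult.assoc fps_mult_left_const_nth
    using assms by (intro sum.cong refl, subst X_power_mult_bern_deriv_nth) auto
  ultimately show ?thesis unfolding bern_deriv_0_mult by (simp del: fps_X_mult_nth)
qed

text \<open>The indices \<open>k\<close> and \<open>m - (1 + k)\<close> have odd sum, so one of them
  is odd. Only \<open>k = 1\<close> survives, with \<open>bern_coeff 1 = - 1 / 2\<close>; the
  Kronecker deltas are the binomials \<open>0 choose s\<close> and
  \<open>0 choose r\<close>.\<close>

lemma X_mult_bern_deriv_mult_nth:
  assumes "even m" "r + s + 4 \<le> m"
  shows "fps_nth (fps_X * (bern_deriv r * bern_deriv s)) m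
     = - ((kronecker_delta r 0 + kronecker_delta s 0) / 2 * real ((m - 3) choose (r + s)) * bern_coeff (m - 2))"
proof -
  let ?t = "\<lambda>k. ((-1) ^ s * real ((k - 1) choose s) + (-1) ^ r * real ((k - 1) choose r))
           * real ((m - (1 + k) - 1) choose (r + s + 1 - k)) * bern_coeff k * bern_coeff (m - (1 + k))"
  have "bern_coeff (m - 1) = 0" using assms by (intro bern_coeff_odd) auto
  then have "fps_nth (fps_X * (bern_deriv r * bern_deriv s)) m = (\<Sum>k = 1..r + s + 1. ?t k)"
    using bern_deriv_mult_nth[of m 1 r s] assms by simp
  also have "\<dots> = (\<Sum>k \<in> {1}. ?t k)"
  proof (intro sum.mono_neutral_right ballI)
    fix k assume k: "k \<in> {1..r + s + 1} - {1}"
    then have "m - (1 + k) \<noteq> 1" using assms by auto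
    then have "bern_coeff k = 0 \<or> bern_coeff (m - (1 + k)) = 0"
      using k assms bern_coeff_odd[of k] bern_coeff_odd[of "m - (1 + k)"] by (cases "odd k") auto
    then show "?t k = 0" by auto
  qed auto
  also have "\<dots> = - ((kronecker_delta r 0 + kronecker_delta s 0) / 2 * real ((m - 3) choose (r + s)) * bern_coeff (m - 2))"
    by (auto simp: kronecker_delta_def bern_coeff_1 binomial_eq_0 numeral_3_eq_3 numeral_2_eq_2)
  finally show ?thesis .
qed

section \<open>The triple product\<close>

text \<open>The summand \<open>j = r + s + 2\<close> of the double sum in \<open>bern_deriv_mult_mult_nth\<close>.\<close>

lemma top_term_vanishes:
  assumes "even m" "r + s + 4 \<le> m" "k \<le> s"
  shows "(- ((-1) ^ s) * real ((r + s + 1 - k) choose (s + 1 - k)) + (-1) ^ (r + k) * real ((r + s + 1 - k) choose r))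
     * (bern_coeff k * bern_coeff (r + s + 2 - k) * bern_coeff (m - (r + s + 2))) = 0"
proof -
  have sym: "(r + s + 1 - k) choose (s + 1 - k) = (r + s + 1 - k) choose r"
    using assms binomial_symmetric[of r "r + s + 1 - k"] by simp
  \<comment> \<open>In the second case the two binomials agree by \<open>sym\<close> and their signs
    are opposite; in each other case a Bernoulli number of odd index at least 3 occurs.\<close>
  consider "odd (r + s)" | "even (r + s)" "even k" | "odd k" "k \<noteq> 1" | "even (r + s)" "k = 1" by blast
  then show ?thesis
  proof cases
    case 1
    then have "bern_coeff (m - (r + s + 2)) = 0" using assms by (intro bern_coeff_odd) auto
    then show ?thesis by simp
  next
    case 2
    then have "(-1 :: real) ^ (r + k) = (-1) ^ s" by (simp add: power_add) (auto simp: uminus_power_if)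
    then show ?thesis using sym by simp
  next
    case 3
    then show ?thesis by (simp add: bern_coeff_odd)
  next
    case 4
    then have "bern_coeff (r + s + 2 - k) = 0" using assms by (intro bern_coeff_odd) auto
    then show ?thesis by simp
  qed
qed

text \<open>Linearises \<open>bern_deriv 0 * bern_deriv s\<close> first, then each product of
  \<open>bern_deriv r\<close> with a resulting derivative. This order causes the asymmetry between
  \<open>r\<close> and \<open>s\<close>.\<close>

lemma bern_deriv_mult_mult_nth:
  assumes "even m" "r + s + 4 \<le> m"
  shows "fps_nth (bern_deriv r * bern_deriv s * bern_deriv 0) m
     = (kronecker_delta r 0 + kronecker_delta s 0) / 2 * real ((m - 3) choose (r + s)) * bern_coeff (m - 2)
       + (\<Sum>k\<le>s. real ((m - k - 1) choose (r + s + 2 - k)) * bern_coeff k * bern_coeff (m - k))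
       - (\<Sum>k\<le>s. \<Sum>j = s + 2..r + s + 1. (-1) ^ s * real ((j - 1 - k) choose (s + 1 - k))
            * real ((m - 1 - j) choose (r + s + 2 - j)) * (bern_coeff k * bern_coeff (j - k) * bern_coeff (m - j)))
       + (\<Sum>k\<le>s. \<Sum>j = r + 1 + k..r + s + 1. (-1) ^ (r + k) * real ((j - 1 - k) choose r)
            * real ((m - 1 - j) choose (r + s + 2 - j)) * (bern_coeff k * bern_coeff (j - k) * bern_coeff (m - j)))"
proof -
  let ?\<beta> = "\<lambda>k j. real ((m - 1 - j) choose (r + s + 2 - j)) * (bern_coeff k * bern_coeff (j - k) * bern_coeff (m - j))"
  let ?p = "\<lambda>k j. (-1) ^ s * real ((j - 1 - k) choose (s + 1 - k)) * ?\<beta> k j"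
  let ?q = "\<lambda>k j. (-1) ^ (r + k) * real ((j - 1 - k) choose r) * ?\<beta> k j"
  let ?F = "\<lambda>k. fps_nth (fps_X ^ k * (bern_deriv r * bern_deriv (s + 1 - k))) m"
  have term_nth: "- (bern_coeff k * ?F k)
     = real ((m - k - 1) choose (r + s + 2 - k)) * bern_coeff k * bern_coeff (m - k)
       - (\<Sum>j = s + 2..r + s + 1. ?p k j) + (\<Sum>j = r + 1 + k..r + s + 1. ?q k j)" if k: "k \<le> s" for k
  proof -
    let ?t = "\<lambda>l. ((-1) ^ (s + 1 - k) * real ((l - 1) choose (s + 1 - k)) + (-1) ^ r * real ((l - 1) choose r))
           * real ((m - (k + l) - 1) choose (r + (s + 1 - k) + 1 - l)) * bern_coeff l * bern_coeff (m - (k + l))"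
    have e: "r + (s + 1 - k) + 1 = r + s + 2 - k" using k by simp
    have sg: "(-1) ^ (s + 1 - k) = - ((-1) ^ s * (-1) ^ k :: real)"
      using k by (auto simp: minus_one_power_iff)
    have F: "?F k = - real ((m - k - 1) choose (r + s + 2 - k)) * bern_coeff (m - k)
        - (-1) ^ k * (\<Sum>l = 1..r + s + 2 - k. ?t l)"
      using bern_deriv_mult_nth[of m k r "s + 1 - k"] assms k unfolding e by simp
    have "- (bern_coeff k * ?F k)
      = real ((m - k - 1) choose (r + s + 2 - k)) * bern_coeff k * bern_coeff (m - k)
        + (\<Sum>l = 1..r + s + 2 - k. (-1) ^ k * bern_coeff k * ?t l)"
      unfolding F sum_distrib_left[symmetric] by (simp add: right_diff_distrib)
    \<comment> \<open>The index \<open>j = k + l\<close> is the total power of \<open>fps_X\<close>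
      split off by the two linearisations.\<close>
    also have "(\<Sum>l = 1..r + s + 2 - k. (-1) ^ k * bern_coeff k * ?t l)
        = (\<Sum>j = k + 1..r + s + 2. (-1) ^ k * bern_coeff k * ?t (j - k))"
      using k by (intro sum.reindex_bij_witness[of _ "\<lambda>j. j - k" "\<lambda>l. l + k"]) auto
    also have "\<dots> = (\<Sum>j = k + 1..r + s + 2. ?q k j - ?p k j)"
    proof (intro sum.cong refl)
      fix j assume j: "j \<in> {k + 1..r + s + 2}"
      then have "k + (j - k) = j" "r + (s + 1 - k) + 1 - (j - k) = r + s + 2 - j" "j - k - 1 = j - 1 - k" "m - j - 1 = m - 1 - j"
        using k by auto
      moreover have "z * b * ((- (u * z) * c + v * c') * d * b' * b'')
          = v * z * c' * (d * (b * b' * b'')) - u * c * (d * (b * b' * b''))"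
        if "z * z = 1" for z b u c v c' d b' b'' :: real
      proof -
        have "z * b * ((- (u * z) * c + v * c') * d * b' * b'')
            = v * z * c' * (d * (b * b' * b'')) - (z * z) * (u * c * (d * (b * b' * b'')))"
          by (simp add: algebra_simps)
        then show ?thesis using that by simp
      qed
      moreover have "(-1) ^ k * (-1) ^ k = (1 :: real)" by (simp flip: power_add)
      ultimately show "(-1) ^ k * bern_coeff k * ?t (j - k) = ?q k j - ?p k j"
        unfolding sg by (simp only: power_add)
    qed
    also have "{k + 1..r + s + 2} = insert (r + s + 2) {k + 1..r + s + 1}" using k by auto
    also have "(\<Sum>j \<in> insert (r + s + 2) {k + 1..r + s + 1}. ?q k j - ?p k j) = (\<Sum>j = k + 1..r + s + 1. ?q k j - ?p k j)"
      using top_term_vanishes[OF assms k] by (simp add: algebra_simps)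
    also have "\<dots> = (\<Sum>j = k + 1..r + s + 1. ?q k j) - (\<Sum>j = k + 1..r + s + 1. ?p k j)"
      by (rule sum_subtractf)
    \<comment> \<open>The binomial in \<open>?q\<close> vanishes for \<open>j \<le> r + k\<close>,
      the one in \<open>?p\<close> for \<open>j \<le> s + 1\<close>; this gives the lower
      limits.\<close>
    also have "(\<Sum>j = k + 1..r + s + 1. ?q k j) = (\<Sum>j = r + 1 + k..r + s + 1. ?q k j)"
      by (rule sum.mono_neutral_right) auto
    also have "(\<Sum>j = k + 1..r + s + 1. ?p k j) = (\<Sum>j = s + 2..r + s + 1. ?p k j)"
      using k by (intro sum.mono_neutral_right) auto
    finally show ?thesis by simp
  qed
  have "bern_deriv r * bern_deriv s * bern_deriv 0 = - (fps_X * (bern_deriv r * bern_deriv s))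
      - (\<Sum>k\<le>s. fps_const (bern_coeff k) * (fps_X ^ k * (bern_deriv r * bern_deriv (s + 1 - k))))"
    using arg_cong[OF bern_deriv_0_mult[of s], of "(*) (bern_deriv r)"]
    by (simp add: algebra_simps sum_distrib_left)
  then have "fps_nth (bern_deriv r * bern_deriv s * bern_deriv 0) m
      = - fps_nth (fps_X * (bern_deriv r * bern_deriv s)) m + (\<Sum>k\<le>s. - (bern_coeff k * ?F k))"
    by (simp only: fps_sub_nth fps_neg_nth fps_sum_nth fps_mult_left_const_nth sum_negf)
  also have "(\<Sum>k\<le>s. - (bern_coeff k * ?F k))
     = (\<Sum>k\<le>s. real ((m - k - 1) choose (r + s + 2 - k)) * bern_coeff k * bern_coeff (m - k)
       - (\<Sum>j = s + 2..r + s + 1. ?p k j) + (\<Sum>j = r + 1 + k..r + s + 1. ?q k j))"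
    by (intro sum.cong refl term_nth) simp
  finally show ?thesis
    unfolding X_mult_bern_deriv_mult_nth[OF assms] by (simp add: sum.distrib sum_subtractf mult.assoc)
qed

section \<open>The sum over triples as a coefficient\<close>

lemma fps_mult3_nth:
  fixes f g h :: "'a :: comm_semiring_1 fps"
  shows "fps_nth (f * g * h) n
     = (\<Sum>(i, j, k) \<in> {(i, j, k). i + j + k = n}. fps_nth f i * fps_nth g j * fps_nth h k)"
proof -
  have "fps_nth (f * g * h) n
      = (\<Sum>(i, j) \<in> Sigma {0..n} (\<lambda>i. {0..n - i}). fps_nth f i * (fps_nth g j * fps_nth h (n - i - j)))"
    unfolding mult.assoc fps_mult_nth sum_distrib_left by (subst sum.Sigma) auto
  also have "\<dots> = (\<Sum>(i, j, k) \<in> {(i, j, k). i + j + k = n}. fps_nth f i * fps_nth g j * fps_nth h k)"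
    by (rule sum.reindex_bij_witness[of _ "\<lambda>(i, j, k). (i, j)" "\<lambda>(i, j). (i, j, n - i - j)"])
      (auto simp: mult.assoc)
  finally show ?thesis .
qed

lemma prod_diff_eq_binomial:
  assumes "i \<ge> 1"
  shows "(\<Prod>a = 1..r. real i - real a) = fact r * real ((i - 1) choose r)"
proof -
  have "(\<Prod>a = 1..r. real i - real a) = (\<Prod>a = 0..<r. real (i - 1) - real a)"
    using assms
    by (intro prod.reindex_bij_witness[of _ Suc "\<lambda>a. a - 1"]) (auto simp: of_nat_diff)
  then show ?thesis by (simp add: binomial_gbinomial gbinomial_prod_rev)
qed

text \<open>Subtracting the constant term \<open>(-1) ^ r\<close> of \<open>bern_deriv r\<close> is
  what restricts the indices to positive values; the linear factors supply \<open>fact r\<close>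
  times a binomial.\<close>

lemma sum_triples_eq_nth:
  fixes m r s :: nat
  defines "g \<equiv> \<lambda>r. bern_deriv r - fps_const ((-1) ^ r)"
  shows "1 / (fact r * fact s) *
       (\<Sum>(i, j, k) \<in> {(i, j, k). i + j + k = m \<and> i \<ge> 1 \<and> j \<ge> 1 \<and> k \<ge> 1}.
          bernoulli i * bernoulli j * bernoulli k / (fact i * fact j * fact k)
          * (\<Prod>a = 1..r. real i - real a) * (\<Prod>b = 1..s. real j - real b))
     = fps_nth (g r * g s * g 0) m"
proof -
  have g: "fps_nth (g r) k = (if k = 0 then 0 else real ((k - 1) choose r) * bern_coeff k)" for r k
    by (simp add: g_def bern_deriv_nth)
  have fin: "finite {(i, j, k). i + j + k = m}"
    by (rule finite_subset[of _ "{..m} \<times> {..m} \<times> {..m}"]) auto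
  have "fps_nth (g r * g s * g 0) m
      = (\<Sum>(i, j, k) \<in> {(i, j, k). i + j + k = m \<and> i \<ge> 1 \<and> j \<ge> 1 \<and> k \<ge> 1}.
            fps_nth (g r) i * fps_nth (g s) j * fps_nth (g 0) k)"
    unfolding fps_mult3_nth using fin by (intro sum.mono_neutral_right) (auto simp: g Suc_le_eq split: if_splits)
  also have "\<dots> = (\<Sum>(i, j, k) \<in> {(i, j, k). i + j + k = m \<and> i \<ge> 1 \<and> j \<ge> 1 \<and> k \<ge> 1}.
          1 / (fact r * fact s) * (bernoulli i * bernoulli j * bernoulli k / (fact i * fact j * fact k)
          * (\<Prod>a = 1..r. real i - real a) * (\<Prod>b = 1..s. real j - real b)))"
    by (intro sum.cong refl) (clarsimp simp: g prod_diff_eq_binomial[unfolded One_nat_def] bern_coeff_def mult_ac)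
  finally show ?thesis by (simp add: sum_distrib_left case_prod_unfold)
qed

section \<open>Assembling the identity\<close>

lemma sum_atMost_split_0:
  fixes f :: "nat \<Rightarrow> 'a :: comm_monoid_add"
  shows "(\<Sum>k\<le>n. f k) = f 0 + (\<Sum>k = 1..n. f k)"
  by (simp add: atMost_atLeast0 sum.atLeast_Suc_atMost)

text \<open>Extends the sum to \<open>k = s + 1\<close>, the range in the theorem. The last term
  compensates: for odd \<open>s\<close> the signs cancel, for even \<open>s\<close> the index
  \<open>m - s - 1\<close> is odd and at least 3.\<close>

lemma bern_deriv_0_mult_nth_full:
  assumes "even m" "s + 4 \<le> m"
  shows "fps_nth (bern_deriv 0 * bern_deriv s) m
     = - real ((m - 1) choose (s + 1)) * bern_coeff m
       - (\<Sum>k = 1..s + 1. real ((m - 1 - k) choose (s + 1 - k)) * bern_coeff k * bern_coeff (m - k))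
       - (-1) ^ s * bern_coeff (s + 1) * bern_coeff (m - s - 1)"
proof -
  have "(-1) ^ s * bern_coeff (s + 1) * bern_coeff (m - s - 1) = - bern_coeff (s + 1) * bern_coeff (m - s - 1)"
  proof (cases "even s")
    case True
    then have "bern_coeff (m - s - 1) = 0" using assms by (intro bern_coeff_odd) auto
    then show ?thesis by simp
  qed simp
  then show ?thesis
    unfolding bern_deriv_0_mult_nth[OF assms] sum_atMost_split_0 by (simp add: diff_commute)
qed

lemma bern_deriv_mult_nth_split:
  assumes "even m" "r + s + 3 \<le> m"
  shows "fps_nth (bern_deriv r * bern_deriv s) m
     = - real ((m - 1) choose (r + s + 1)) * bern_coeff m
       - (-1) ^ r * (\<Sum>k = r + 1..r + s + 1. real ((k - 1) choose r)
           * real ((m - k - 1) choose (s + r + 1 - k)) * bern_coeff k * bern_coeff (m - k))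
       - (-1) ^ s * (\<Sum>k = s + 1..s + r + 1. real ((k - 1) choose s)
           * real ((m - k - 1) choose (r + s + 1 - k)) * bern_coeff k * bern_coeff (m - k))"
proof -
  let ?t = "\<lambda>r s k. real ((k - 1) choose r) * real ((m - k - 1) choose (s + r + 1 - k)) * bern_coeff k * bern_coeff (m - k)"
  have restrict: "(\<Sum>k = 1..r + s + 1. ?t r s k) = (\<Sum>k = r + 1..r + s + 1. ?t r s k)" for r s
    by (rule sum.mono_neutral_right) auto
  have "fps_nth (bern_deriv r * bern_deriv s) m
     = - real ((m - 1) choose (r + s + 1)) * bern_coeff m
       - (\<Sum>k = 1..r + s + 1. (-1) ^ r * ?t r s k + (-1) ^ s * ?t s r k)"
    using bern_deriv_mult_nth[of m 0 r s] assms by (simp add: algebra_simps)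
  then show ?thesis
    using restrict[of r s] restrict[of s r]
    by (simp add: sum.distrib sum_distrib_left[symmetric] add.commute)
qed

theorem theorem4p1:
  fixes r\<^sub>1 r\<^sub>2 n :: nat
  assumes "n > 0" and "n \<ge> r\<^sub>1 + r\<^sub>2 + 2"
  shows
    "1 / (fact r\<^sub>1 * fact r\<^sub>2) *
       (\<Sum>(i, j, k) \<in> {(i, j, k). i + j + k = 2 * n \<and> i \<ge> 1 \<and> j \<ge> 1 \<and> k \<ge> 1}.
          bernoulli i * bernoulli j * bernoulli k / (fact i * fact j * fact k)
          * (\<Prod>a = 1..r\<^sub>1. real i - real a) * (\<Prod>b = 1..r\<^sub>2. real j - real b))
     = Cyc (\<lambda>r\<^sub>1 r\<^sub>2.
           (-1) ^ (r\<^sub>1 + r\<^sub>2) * bernoulli (r\<^sub>1 + 1) * bernoulli (2 * n - r\<^sub>1 - 1)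
             / (fact (r\<^sub>1 + 1) * fact (2 * n - r\<^sub>1 - 1))
           + kronecker_delta r\<^sub>1 0 / 2 * real ((2 * n - 3) choose r\<^sub>2)
             * (bernoulli (2 * n - 2) / fact (2 * n - 2))) r\<^sub>1 r\<^sub>2
       + (real ((2 * n) choose (r\<^sub>1 + r\<^sub>2 + 2))
          + Cyc (\<lambda>r\<^sub>1 r\<^sub>2. (-1) ^ r\<^sub>2 * real ((2 * n) choose (r\<^sub>1 + 1))) r\<^sub>1 r\<^sub>2
          + (-1) ^ (r\<^sub>1 + r\<^sub>2)) * (bernoulli (2 * n) / fact (2 * n))
       + Cyc (\<lambda>r\<^sub>1 r\<^sub>2. (-1) ^ r\<^sub>1 *
           (\<Sum>k = r\<^sub>1 + 1..r\<^sub>1 + r\<^sub>2 + 1.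
              real ((k - 1) choose r\<^sub>1) * real ((2 * n - k - 1) choose (r\<^sub>2 + r\<^sub>1 + 1 - k))
              * (bernoulli k / fact k) * (bernoulli (2 * n - k) / fact (2 * n - k)))) r\<^sub>1 r\<^sub>2
       + Cyc (\<lambda>r\<^sub>1 r\<^sub>2. (-1) ^ r\<^sub>2 *
           (\<Sum>k = 1..r\<^sub>1 + 1.
              real ((2 * n - 1 - k) choose (r\<^sub>1 + 1 - k))
              * (bernoulli k / fact k) * (bernoulli (2 * n - k) / fact (2 * n - k)))) r\<^sub>1 r\<^sub>2
       + (\<Sum>k = 1..r\<^sub>2.
            (-1) ^ k * real ((2 * n - 1 - k) choose (r\<^sub>1 + r\<^sub>2 + 2 - k))
            * (bernoulli k / fact k) * (bernoulli (2 * n - k) / fact (2 * n - k)))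
       - (\<Sum>k = 0..r\<^sub>2. \<Sum>j = r\<^sub>2 + 2..r\<^sub>1 + r\<^sub>2 + 1.
            (-1) ^ r\<^sub>2 * real ((j - 1 - k) choose (r\<^sub>2 + 1 - k))
            * real ((2 * n - 1 - j) choose (r\<^sub>1 + r\<^sub>2 + 2 - j))
            * (bernoulli k * bernoulli (j - k) * bernoulli (2 * n - j)
               / (fact k * fact (j - k) * fact (2 * n - j))))
       + (\<Sum>k = 0..r\<^sub>2. \<Sum>j = r\<^sub>1 + 1 + k..r\<^sub>1 + r\<^sub>2 + 1.
            (-1) ^ (r\<^sub>1 + k) * real ((j - 1 - k) choose r\<^sub>1)
            * real ((2 * n - 1 - j) choose (r\<^sub>1 + r\<^sub>2 + 2 - j))
            * (bernoulli k * bernoulli (j - k) * bernoulli (2 * n - j)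
               / (fact k * fact (j - k) * fact (2 * n - j))))"
proof -
  define m where "m = 2 * n"
  define \<beta> where "\<beta> = bern_coeff m"
  let ?h = bern_deriv and ?b = bern_coeff
  let ?K = "\<lambda>r s. \<Sum>k = r + 1..r + s + 1. real ((k - 1) choose r)
           * real ((m - k - 1) choose (s + r + 1 - k)) * ?b k * ?b (m - k)"
  let ?S = "\<lambda>s. \<Sum>k = 1..s + 1. real ((m - 1 - k) choose (s + 1 - k)) * ?b k * ?b (m - k)"
  let ?T = "\<Sum>k = 1..r\<^sub>2. (-1) ^ k * real ((m - 1 - k) choose (r\<^sub>1 + r\<^sub>2 + 2 - k)) * ?b k * ?b (m - k)"
  let ?V = "\<Sum>k = 0..r\<^sub>2. \<Sum>j = r\<^sub>2 + 2..r\<^sub>1 + r\<^sub>2 + 1. (-1) ^ r\<^sub>2 * real ((j - 1 - k) choose (r\<^sub>2 + 1 - k))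
            * real ((m - 1 - j) choose (r\<^sub>1 + r\<^sub>2 + 2 - j)) * (?b k * ?b (j - k) * ?b (m - j))"
  let ?W = "\<Sum>k = 0..r\<^sub>2. \<Sum>j = r\<^sub>1 + 1 + k..r\<^sub>1 + r\<^sub>2 + 1. (-1) ^ (r\<^sub>1 + k) * real ((j - 1 - k) choose r\<^sub>1)
            * real ((m - 1 - j) choose (r\<^sub>1 + r\<^sub>2 + 2 - j)) * (?b k * ?b (j - k) * ?b (m - j))"
  have m: "even m" "r\<^sub>1 + r\<^sub>2 + 4 \<le> m" using assms by (auto simp: m_def)
  \<comment> \<open>Merges multiples of \<open>\<beta>\<close> from different products: the triple
    product with the pair, and each product with \<open>?h 0\<close> with a single series.\<close>
  have pascal: "real (m choose (l + 1)) = real ((m - 1) choose l) + real ((m - 1) choose (l + 1))" for l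
    using m by (cases m) auto
  have coeff: "bernoulli k / fact k = ?b k" for k
    by (simp add: bern_coeff_def)
  have coeff2: "z * bernoulli i * bernoulli j / (fact i * fact j) = z * ?b i * ?b j" for z i j
    by (simp add: bern_coeff_def)
  have coeff3: "bernoulli i * bernoulli j * bernoulli k / (fact i * fact j * fact k) = ?b i * ?b j * ?b k" for i j k
    by (simp add: bern_coeff_def)
  have triple: "fps_nth (?h r\<^sub>1 * ?h r\<^sub>2 * ?h 0) m
      = (kronecker_delta r\<^sub>1 0 + kronecker_delta r\<^sub>2 0) / 2 * real ((m - 3) choose (r\<^sub>1 + r\<^sub>2)) * ?b (m - 2)
        + real ((m - 1) choose (r\<^sub>1 + r\<^sub>2 + 2)) * \<beta> + ?T - ?V + ?W"
  proof -
    \<comment> \<open>The sign \<open>(-1) ^ k\<close> in \<open>?T\<close> has no effect, by the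
      parity of \<open>m - k\<close>.\<close>
    have "(\<Sum>k = 1..r\<^sub>2. real ((m - k - 1) choose (r\<^sub>1 + r\<^sub>2 + 2 - k)) * ?b k * ?b (m - k)) = ?T"
    proof (intro sum.cong refl)
      fix k assume "k \<in> {1..r\<^sub>2}"
      then have "(-1) ^ k * ?b (m - k) = ?b (m - k)" using m by (intro bern_coeff_diff_parity) auto
      then show "real ((m - k - 1) choose (r\<^sub>1 + r\<^sub>2 + 2 - k)) * ?b k * ?b (m - k)
          = (-1) ^ k * real ((m - 1 - k) choose (r\<^sub>1 + r\<^sub>2 + 2 - k)) * ?b k * ?b (m - k)"
        by (auto simp: diff_commute mult_ac)
    qed
    then have "(\<Sum>k\<le>r\<^sub>2. real ((m - k - 1) choose (r\<^sub>1 + r\<^sub>2 + 2 - k)) * ?b k * ?b (m - k))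
        = real ((m - 1) choose (r\<^sub>1 + r\<^sub>2 + 2)) * \<beta> + ?T"
      unfolding sum_atMost_split_0 by (simp add: \<beta>_def)
    then show ?thesis
      unfolding bern_deriv_mult_mult_nth[OF m] by (simp only: atMost_atLeast0 add.assoc add_diff_eq)
  qed
  \<comment> \<open>Each delta sets one of the two orders to zero, so
    \<open>r\<^sub>1 + r\<^sub>2\<close> becomes the other one.\<close>
  have delta: "(kronecker_delta r\<^sub>1 0 + kronecker_delta r\<^sub>2 0) / 2 * real ((m - 3) choose (r\<^sub>1 + r\<^sub>2)) * ?b (m - 2)
      = kronecker_delta r\<^sub>1 0 / 2 * real ((m - 3) choose r\<^sub>2) * ?b (m - 2)
        + kronecker_delta r\<^sub>2 0 / 2 * real ((m - 3) choose r\<^sub>1) * ?b (m - 2)"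
    by (auto simp: kronecker_delta_def)
  have "(?h r\<^sub>1 - fps_const ((-1) ^ r\<^sub>1)) * (?h r\<^sub>2 - fps_const ((-1) ^ r\<^sub>2)) * (?h 0 - fps_const ((-1) ^ 0))
      = ?h r\<^sub>1 * ?h r\<^sub>2 * ?h 0 - ?h r\<^sub>1 * ?h r\<^sub>2
        - fps_const ((-1) ^ r\<^sub>1) * (?h 0 * ?h r\<^sub>2) - fps_const ((-1) ^ r\<^sub>2) * (?h 0 * ?h r\<^sub>1)
        + fps_const ((-1) ^ r\<^sub>1) * ?h r\<^sub>2 + fps_const ((-1) ^ r\<^sub>2) * ?h r\<^sub>1
        + fps_const ((-1) ^ r\<^sub>1 * (-1) ^ r\<^sub>2) * ?h 0 - fps_const ((-1) ^ r\<^sub>1 * (-1) ^ r\<^sub>2)"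
    unfolding fps_const_mult[symmetric] by (simp add: algebra_simps del: fps_const_mult)
  \<comment> \<open>The final constant of the expansion contributes nothing because
    \<open>m > 0\<close>.\<close>
  then have sum_eq: "fps_nth ((?h r\<^sub>1 - fps_const ((-1) ^ r\<^sub>1)) * (?h r\<^sub>2 - fps_const ((-1) ^ r\<^sub>2))
        * (?h 0 - fps_const ((-1) ^ 0))) m
      = fps_nth (?h r\<^sub>1 * ?h r\<^sub>2 * ?h 0) m - fps_nth (?h r\<^sub>1 * ?h r\<^sub>2) m
        - (-1) ^ r\<^sub>1 * fps_nth (?h 0 * ?h r\<^sub>2) m - (-1) ^ r\<^sub>2 * fps_nth (?h 0 * ?h r\<^sub>1) m
        + (-1) ^ r\<^sub>1 * (real ((m - 1) choose r\<^sub>2) * \<beta>) + (-1) ^ r\<^sub>2 * (real ((m - 1) choose r\<^sub>1) * \<beta>)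
        + (-1) ^ r\<^sub>1 * (-1) ^ r\<^sub>2 * \<beta>"
    using m by (simp only: fps_add_nth fps_sub_nth fps_mult_left_const_nth) (simp add: bern_deriv_nth \<beta>_def)
  have pair: "fps_nth (?h r\<^sub>1 * ?h r\<^sub>2) m
      = - real ((m - 1) choose (r\<^sub>1 + r\<^sub>2 + 1)) * \<beta> - (-1) ^ r\<^sub>1 * ?K r\<^sub>1 r\<^sub>2 - (-1) ^ r\<^sub>2 * ?K r\<^sub>2 r\<^sub>1"
    unfolding \<beta>_def using m by (intro bern_deriv_mult_nth_split) auto
  have pair\<^sub>1: "fps_nth (?h 0 * ?h r\<^sub>1) m
      = - real ((m - 1) choose (r\<^sub>1 + 1)) * \<beta> - ?S r\<^sub>1 - (-1) ^ r\<^sub>1 * ?b (r\<^sub>1 + 1) * ?b (m - r\<^sub>1 - 1)"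
    unfolding \<beta>_def using m by (intro bern_deriv_0_mult_nth_full) auto
  have pair\<^sub>2: "fps_nth (?h 0 * ?h r\<^sub>2) m
      = - real ((m - 1) choose (r\<^sub>2 + 1)) * \<beta> - ?S r\<^sub>2 - (-1) ^ r\<^sub>2 * ?b (r\<^sub>2 + 1) * ?b (m - r\<^sub>2 - 1)"
    unfolding \<beta>_def using m by (intro bern_deriv_0_mult_nth_full) auto
  have pascal2: "real (m choose (r\<^sub>1 + r\<^sub>2 + 2))
      = real ((m - 1) choose (r\<^sub>1 + r\<^sub>2 + 1)) + real ((m - 1) choose (r\<^sub>1 + r\<^sub>2 + 2))"
    using pascal[of "r\<^sub>1 + r\<^sub>2 + 1"] by simp
  show ?thesis
    unfolding m_def[symmetric] sum_triples_eq_nth sum_eq triple delta pair pair\<^sub>1 pair\<^sub>2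
    unfolding Cyc_def coeff coeff2 coeff3 \<beta>_def[symmetric] pascal pascal2
      power_add[of _ r\<^sub>1 r\<^sub>2] power_add[of _ r\<^sub>2 r\<^sub>1]
    by (simp only: mult_minus_left mult_minus_right minus_minus algebra_simps)
qed

end
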